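(* Let $\Bbbk$ be a field of characteristic $0$ and let $\mathfrak{g}$ be an infinite-dimensional Lie subalgebra of $W_{\geq -1} = \operatorname{Der}(\Bbbk[t])$. If the set of ratios $R(\mathfrak{g})$ is a field, then the universal enveloping algebra $U(\mathfrak{g})$ is not noetherian.
   Context: $W_{\geq -1} = \operatorname{Der}(\Bbbk[t]) = \Bbbk[t]\partial$, where $\partial$ is differentiation with respect to $t$, with Lie bracket $[f\partial, g\partial] = (fg' - f'g)\partial$. For a Lie subalgebra $\mathfrak{g} \subseteq W_{\geq -1}$, the set of ratios is $R(\mathfrak{g}) = \{ \frac{w}{u} \in \Bbbk(t) \mid w\partial, u\partial \in \mathfrak{g},\ u \neq 0\}$; "is a field" means it is a subfield of $\Bbbk(t)$. Noetherian means left and right noetherian (equivalent to each other for universal enveloping algebras). *)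

theory Defs
  imports
    "HOL-Algebra.Algebra"
    "HOL-Algebra.Algebraic_Closure_Type"
    "HOL-Computational_Algebra.Polynomial"
    "HOL-Computational_Algebra.Fraction_Field"
begin

section \<open>Noetherian rings, not necessarily commutative\<close>

text \<open>The library's \<^locale>\<open>noetherian_ring\<close> is about two-sided ideals, so it does not express
  the one-sided conditions needed here.\<close>

definition left_ideal :: "'a set \<Rightarrow> ('a, 'b) ring_scheme \<Rightarrow> bool" where
  "left_ideal I R \<longleftrightarrow> additive_subgroup I R \<and>
     (\<forall>r\<in>carrier R. \<forall>a\<in>I. r \<otimes>\<^bsub>R\<^esub> a \<in> I)"

definition right_ideal :: "'a set \<Rightarrow> ('a, 'b) ring_scheme \<Rightarrow> bool" where
  "right_ideal I R \<longleftrightarrow> additive_subgroup I R \<and>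
     (\<forall>r\<in>carrier R. \<forall>a\<in>I. a \<otimes>\<^bsub>R\<^esub> r \<in> I)"

definition left_noetherian :: "('a, 'b) ring_scheme \<Rightarrow> bool" where
  "left_noetherian R \<longleftrightarrow>
     (\<forall>I :: nat \<Rightarrow> 'a set. (\<forall>n. left_ideal (I n) R \<and> I n \<subseteq> I (Suc n)) \<longrightarrow>
        (\<exists>n. \<forall>m\<ge>n. I m = I n))"

definition right_noetherian :: "('a, 'b) ring_scheme \<Rightarrow> bool" where
  "right_noetherian R \<longleftrightarrow>
     (\<forall>I :: nat \<Rightarrow> 'a set. (\<forall>n. right_ideal (I n) R \<and> I n \<subseteq> I (Suc n)) \<longrightarrow>
        (\<exists>n. \<forall>m\<ge>n. I m = I n))"

definition noetherian :: "('a, 'b) ring_scheme \<Rightarrow> bool" where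
  "noetherian R \<longleftrightarrow> left_noetherian R \<and> right_noetherian R"


section \<open>The free associative algebra\<close>

text \<open>A noncommutative polynomial over \<open>'k\<close> in the set of indeterminates \<open>A\<close> is given by its
  coefficients on words in \<open>A\<close>; the product is convolution along all factorizations of a word
  into a prefix and a suffix.\<close>

definition free_algebra :: "'v set \<Rightarrow> ('v list \<Rightarrow> 'k::comm_ring_1) ring" where
  "free_algebra A =
     \<lparr>carrier = {f. finite {w. f w \<noteq> 0} \<and> (\<forall>w. f w \<noteq> 0 \<longrightarrow> set w \<subseteq> A)},
      monoid.mult = (\<lambda>f g w. \<Sum>i\<le>length w. f (take i w) * g (drop i w)),
      one = (\<lambda>w. if w = [] then 1 else 0),
      ring.zero = (\<lambda>w. 0),
      add = (\<lambda>f g w. f w + g w)\<rparr>"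

definition word_term :: "'v list \<Rightarrow> 'k \<Rightarrow> 'v list \<Rightarrow> 'k::comm_ring_1" where
  "word_term u c = (\<lambda>w. if w = u then c else 0)"

lemma free_algebra_ring: "ring (free_algebra A :: ('v list \<Rightarrow> 'k::comm_ring_1) ring)"
proof -
  let ?F = "free_algebra A :: ('v list \<Rightarrow> 'k) ring"
  let ?C = "carrier ?F"
  have neg: "(\<lambda>w. - f w) \<in> ?C" if "f \<in> ?C" for f
    using that by (simp add: free_algebra_def)
  have add_closed: "(\<lambda>w. f w + g w) \<in> ?C" if f: "f \<in> ?C" and g: "g \<in> ?C" for f g
  proof -
    have sub: "{w. f w + g w \<noteq> 0} \<subseteq> {w. f w \<noteq> 0} \<union> {w. g w \<noteq> 0}" by auto
    have "finite ({w. f w \<noteq> 0} \<union> {w. g w \<noteq> 0})" using f g by (simp add: free_algebra_def)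
    with sub have fin: "finite {w. f w + g w \<noteq> 0}" by (rule finite_subset)
    have "set w \<subseteq> A" if "f w + g w \<noteq> 0" for w
    proof -
      have "f w \<noteq> 0 \<or> g w \<noteq> 0" using that by auto
      moreover have "f w \<noteq> 0 \<longrightarrow> set w \<subseteq> A" "g w \<noteq> 0 \<longrightarrow> set w \<subseteq> A"
        using f g unfolding free_algebra_def by simp_all
      ultimately show ?thesis by blast
    qed
    with fin show ?thesis by (simp add: free_algebra_def)
  qed
  have mult_closed: "f \<otimes>\<^bsub>?F\<^esub> g \<in> ?C" if f: "f \<in> ?C" and g: "g \<in> ?C" for f g
  proof -
    have split: "\<exists>u v. w = u @ v \<and> f u \<noteq> 0 \<and> g v \<noteq> 0" if "(f \<otimes>\<^bsub>?F\<^esub> g) w \<noteq> 0" for w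
    proof -
      obtain i where "f (take i w) * g (drop i w) \<noteq> 0"
        using \<open>(f \<otimes>\<^bsub>?F\<^esub> g) w \<noteq> 0\<close> by (auto simp: free_algebra_def elim: sum.not_neutral_contains_not_neutral)
      then have "f (take i w) \<noteq> 0" "g (drop i w) \<noteq> 0" by auto
      then show ?thesis by (intro exI[of _ "take i w"] exI[of _ "drop i w"]) simp
    qed
    have "{w. (f \<otimes>\<^bsub>?F\<^esub> g) w \<noteq> 0} \<subseteq> (\<lambda>(u, v). u @ v) ` ({u. f u \<noteq> 0} \<times> {v. g v \<noteq> 0})"
      using split by force
    moreover have "finite ({u. f u \<noteq> 0} \<times> {v. g v \<noteq> 0})"
      using f g by (simp add: free_algebra_def)
    ultimately have fin: "finite {w. (f \<otimes>\<^bsub>?F\<^esub> g) w \<noteq> 0}"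
      by (meson finite_imageI finite_subset)
    have "set w \<subseteq> A" if "(f \<otimes>\<^bsub>?F\<^esub> g) w \<noteq> 0" for w
      using split[OF that] f g by (force simp: free_algebra_def)
    with fin show ?thesis by (simp add: free_algebra_def)
  qed
  have assoc: "(f \<otimes>\<^bsub>?F\<^esub> g) \<otimes>\<^bsub>?F\<^esub> h = f \<otimes>\<^bsub>?F\<^esub> (g \<otimes>\<^bsub>?F\<^esub> h)" for f g h
  proof
    fix w :: "'v list"
    let ?n = "length w"
    let ?t = "\<lambda>j k. f (take j w) * g (take k (drop j w)) * h (drop (j + k) w)"
    have "((f \<otimes>\<^bsub>?F\<^esub> g) \<otimes>\<^bsub>?F\<^esub> h) w = (\<Sum>i\<le>?n. \<Sum>j\<le>i. ?t j (i - j))"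
      by (auto simp: free_algebra_def sum_distrib_right min_absorb2 min_absorb1 drop_take
          intro!: sum.cong)
    also have "\<dots> = (\<Sum>(j, k)\<in>{(j, k). j + k \<le> ?n}. ?t j k)"
      by (rule sum.triangle_reindex_eq[symmetric])
    also have "\<dots> = (\<Sum>(j, k)\<in>(SIGMA j:{..?n}. {..?n - j}). ?t j k)"
      by (rule sum.cong) auto
    also have "\<dots> = (\<Sum>j\<le>?n. \<Sum>k\<le>?n - j. ?t j k)"
      by (subst sum.Sigma) auto
    also have "\<dots> = (f \<otimes>\<^bsub>?F\<^esub> (g \<otimes>\<^bsub>?F\<^esub> h)) w"
      by (auto simp: free_algebra_def sum_distrib_left mult.assoc add.commute intro!: sum.cong)
    finally show "((f \<otimes>\<^bsub>?F\<^esub> g) \<otimes>\<^bsub>?F\<^esub> h) w = (f \<otimes>\<^bsub>?F\<^esub> (g \<otimes>\<^bsub>?F\<^esub> h)) w" .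
  qed
  have one_l: "\<one>\<^bsub>?F\<^esub> \<otimes>\<^bsub>?F\<^esub> f = f" for f
  proof
    fix w :: "'v list"
    have "(\<one>\<^bsub>?F\<^esub> \<otimes>\<^bsub>?F\<^esub> f) w = (\<Sum>i\<le>length w. if i = 0 then f w else 0)"
      unfolding free_algebra_def monoid.simps ring.simps by (rule sum.cong) auto
    then show "(\<one>\<^bsub>?F\<^esub> \<otimes>\<^bsub>?F\<^esub> f) w = f w" by simp
  qed
  have one_r: "f \<otimes>\<^bsub>?F\<^esub> \<one>\<^bsub>?F\<^esub> = f" for f
  proof
    fix w :: "'v list"
    have "(f \<otimes>\<^bsub>?F\<^esub> \<one>\<^bsub>?F\<^esub>) w = (\<Sum>i\<le>length w. if i = length w then f w else 0)"
      unfolding free_algebra_def monoid.simps ring.simps by (rule sum.cong) auto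
    then show "(f \<otimes>\<^bsub>?F\<^esub> \<one>\<^bsub>?F\<^esub>) w = f w" by simp
  qed
  show ?thesis
  proof (rule ringI)
    show "abelian_group ?F"
    proof (rule abelian_groupI)
      fix f assume "f \<in> ?C"
      then show "\<exists>g\<in>?C. g \<oplus>\<^bsub>?F\<^esub> f = \<zero>\<^bsub>?F\<^esub>"
        by (intro bexI[OF _ neg]) (simp_all add: free_algebra_def)
    next
      fix f g assume "f \<in> ?C" "g \<in> ?C"
      from add_closed[OF this] show "f \<oplus>\<^bsub>?F\<^esub> g \<in> ?C" by (simp add: free_algebra_def)
    qed (simp_all add: free_algebra_def ac_simps)
    show "Group.monoid ?F"
    proof (rule monoidI)
      show "\<one>\<^bsub>?F\<^esub> \<in> ?C" by (auto simp: free_algebra_def)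
    qed (simp_all only: mult_closed assoc one_l one_r)
    show "(f \<oplus>\<^bsub>?F\<^esub> g) \<otimes>\<^bsub>?F\<^esub> h = f \<otimes>\<^bsub>?F\<^esub> h \<oplus>\<^bsub>?F\<^esub> g \<otimes>\<^bsub>?F\<^esub> h" for f g h
      by (simp add: free_algebra_def distrib_right sum.distrib)
    show "h \<otimes>\<^bsub>?F\<^esub> (f \<oplus>\<^bsub>?F\<^esub> g) = h \<otimes>\<^bsub>?F\<^esub> f \<oplus>\<^bsub>?F\<^esub> h \<otimes>\<^bsub>?F\<^esub> g" for f g h
      by (simp add: free_algebra_def distrib_left sum.distrib)
  qed
qed


section \<open>Lie algebras and universal enveloping algebras\<close>

text \<open>Everything is relative to an ambient Lie algebra with scalar multiplication \<open>scale\<close> and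
  bracket \<open>br\<close>.\<close>

definition lie_subalgebra ::
    "('k::field \<Rightarrow> 'v::ab_group_add \<Rightarrow> 'v) \<Rightarrow> ('v \<Rightarrow> 'v \<Rightarrow> 'v) \<Rightarrow> 'v set \<Rightarrow> bool" where
  "lie_subalgebra scale br L \<longleftrightarrow>
     module.subspace scale L \<and> (\<forall>x\<in>L. \<forall>y\<in>L. br x y \<in> L)"

definition infinite_dimensional :: "('k::field \<Rightarrow> 'v::ab_group_add \<Rightarrow> 'v) \<Rightarrow> 'v set \<Rightarrow> bool" where
  "infinite_dimensional scale V \<longleftrightarrow> \<not> (\<exists>B. finite B \<and> module.span scale B = V)"

text \<open>The enveloping algebra of \<open>L\<close> is the tensor algebra of \<open>L\<close> modulo
  \<open>x \<otimes> y - y \<otimes> x - [x, y]\<close>. The tensor algebra is itself the free associative algebra on the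
  set \<open>L\<close> modulo the relations expressing that \<open>L \<rightarrow> T(L)\<close> is linear, so both families of
  relations are factored out of the free algebra together. In a word \<open>[x, y]\<close> below the brackets
  are list brackets.\<close>

definition enveloping_relations ::
    "('k::field \<Rightarrow> 'v::ab_group_add \<Rightarrow> 'v) \<Rightarrow> ('v \<Rightarrow> 'v \<Rightarrow> 'v) \<Rightarrow> 'v set \<Rightarrow> ('v list \<Rightarrow> 'k) set" where
  "enveloping_relations scale br L =
     {\<lambda>w. word_term [x + y] 1 w - word_term [x] 1 w - word_term [y] 1 w | x y. x \<in> L \<and> y \<in> L} \<union>
     {\<lambda>w. word_term [scale c x] 1 w - word_term [x] c w | c x. x \<in> L} \<union>
     {\<lambda>w. word_term [x, y] 1 w - word_term [y, x] 1 w - word_term [br x y] 1 w | x y. x \<in> L \<and> y \<in> L}"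

definition universal_enveloping_algebra ::
    "('k::field \<Rightarrow> 'v::ab_group_add \<Rightarrow> 'v) \<Rightarrow> ('v \<Rightarrow> 'v \<Rightarrow> 'v) \<Rightarrow> 'v set \<Rightarrow> ('v list \<Rightarrow> 'k) set ring" where
  "universal_enveloping_algebra scale br L =
     free_algebra L Quot (Idl\<^bsub>free_algebra L\<^esub> (enveloping_relations scale br L))"

lemma word_term_carrier: "set u \<subseteq> A \<Longrightarrow> word_term u c \<in> carrier (free_algebra A)"
  by (auto simp: word_term_def free_algebra_def)

lemma free_algebra_minus_closed:
  fixes f g :: "'v list \<Rightarrow> 'k::comm_ring_1"
  assumes "f \<in> carrier (free_algebra A)" "g \<in> carrier (free_algebra A)"
  shows "(\<lambda>w. f w - g w) \<in> carrier (free_algebra A)"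
proof -
  interpret ring "free_algebra A :: ('v list \<Rightarrow> 'k) ring" by (rule free_algebra_ring)
  have "(\<lambda>w. - g w) \<in> carrier (free_algebra A)" using assms by (simp add: free_algebra_def)
  from add.m_closed[OF assms(1) this] show ?thesis by (simp add: free_algebra_def)
qed

lemma enveloping_relations_carrier:
  assumes "Modules.module scale" "lie_subalgebra scale br L"
  shows "enveloping_relations scale br L \<subseteq> carrier (free_algebra L)"
proof -
  note cl = module.subspace_add[OF assms(1)] module.subspace_scale[OF assms(1)]
  show ?thesis using assms(2)
    by (auto simp: enveloping_relations_def lie_subalgebra_def
        intro!: free_algebra_minus_closed word_term_carrier cl)
qed

lemma universal_enveloping_algebra_ring:
  assumes "Modules.module scale" "lie_subalgebra scale br L"
  shows "ring (universal_enveloping_algebra scale br L)"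
  unfolding universal_enveloping_algebra_def
  by (intro ideal.quotient_is_ring ring.genideal_ideal free_algebra_ring
      enveloping_relations_carrier[OF assms])


section \<open>Derivations of the polynomial ring\<close>

text \<open>The derivation \<open>f\<partial>\<close> of \<open>k[t]\<close> is encoded by the polynomial \<open>f\<close>, so that the Lie algebra
  of all derivations lives on the whole type \<open>'k poly\<close>, with scalar multiplication
  \<^const>\<open>Polynomial.smult\<close> and the bracket below. The next two lemmas justify this.\<close>

definition W_bracket :: "'k::field_char_0 poly \<Rightarrow> 'k poly \<Rightarrow> 'k poly" where
  "W_bracket f g = f * pderiv g - pderiv f * g"

lemma W_bracket_commutator:
  "W_bracket f g * pderiv p = f * pderiv (g * pderiv p) - g * pderiv (f * pderiv p)"
  by (simp add: W_bracket_def pderiv_mult algebra_simps)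

lemma derivation_poly_iff:
  fixes D :: "'k::field_char_0 poly \<Rightarrow> 'k poly"
  shows "(\<forall>p q. D (p + q) = D p + D q) \<and> (\<forall>c p. D (Polynomial.smult c p) = Polynomial.smult c (D p)) \<and>
      (\<forall>p q. D (p * q) = D p * q + p * D q) \<longleftrightarrow> (\<exists>f. \<forall>p. D p = f * pderiv p)"
    (is "?L \<longleftrightarrow> ?R")
proof
  assume L: ?L
  have 1: "D 1 = 0" using L[THEN conjunct2, THEN conjunct2, rule_format, of 1 1] by simp
  have const: "D [:c:] = 0" for c
  proof -
    have "[:c:] = Polynomial.smult c 1" by simp
    then show ?thesis using L 1 by (metis smult_0_right)
  qed
  have "D p = D [:0, 1:] * pderiv p" for p
  proof (induction p)
    case 0
    show ?case using const[of 0] by simp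
  next
    case (pCons a p)
    have "pCons a p = [:a:] + [:0, 1:] * p" by simp
    then have "D (pCons a p) = D [:a:] + (D [:0, 1:] * p + [:0, 1:] * D p)" using L by metis
    then have "D (pCons a p) = D [:0, 1:] * p + [:0, 1:] * D p" using const by simp
    then show ?case using pCons by (simp add: pderiv_pCons algebra_simps)
  qed
  then show ?R by blast
next
  assume ?R
  then show ?L by (auto simp: pderiv_add pderiv_smult pderiv_mult algebra_simps)
qed

lemma module_poly: "Modules.module (Polynomial.smult :: 'k::field_char_0 \<Rightarrow> 'k poly \<Rightarrow> 'k poly)"
  by standard (simp_all add: smult_add_left smult_add_right)

definition ratios :: "'k::field_char_0 poly set \<Rightarrow> 'k poly fract set" where
  "ratios L = {Fract w u | w u. w \<in> L \<and> u \<in> L \<and> u \<noteq> 0}"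

end

theory Submission
  imports Defs "HOL-Library.Product_Plus"
begin

text \<open>The theorem holds because the right noetherian condition already fails, and the failure is
  visible on one small module. Let a Lie algebra act on a space \<open>E\<close> with a submodule \<open>M\<close> and a vector
  \<open>e\<close> that the Lie algebra maps into \<open>M\<close>, and let \<open>P\<close> be the annihilator of \<open>M\<close> in the enveloping
  algebra. For \<open>x \<in> P\<close> and any \<open>y\<close>, the vector \<open>y e\<close> is a multiple of \<open>e\<close> modulo \<open>M\<close>, so \<open>x y e\<close> is a
  multiple of \<open>x e\<close>. Were \<open>P\<close> finitely generated as a right ideal, the space \<open>P e\<close> would have finite
  dimension. The lemma \<open>not_right_noetherianI\<close> states this in terms of ascending chains.

  The criterion is applied to the extension of the trivial module by \<open>k[t]\<close> given by the divergence
  cocycle \<open>f\<partial> \<mapsto> f'\<close>. For \<open>u\<^sub>i, v\<^sub>i\<close> in the Lie algebra with \<open>\<Sum>u\<^sub>iv\<^sub>i = 0\<close>, the element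
  \<open>\<Sum>(u\<^sub>iv\<^sub>i + v\<^sub>iu\<^sub>i)\<close> of the enveloping algebra annihilates \<open>k[t]\<close> and sends \<open>e\<close> to
  \<open>-2\<Sum>u\<^sub>i'v\<^sub>i'\<close> (lemma \<open>quadratic_pairs_act\<close>). It remains to find such relations for which the
  polynomials \<open>\<Sum>u\<^sub>i'v\<^sub>i'\<close> have unbounded degree.

  The hypothesis on the ratios makes a comparison of sizes possible. The degrees of the elements of
  the field of ratios form a group \<open>d\<int>\<close>. On the one hand, every nonzero \<open>\<Sum>u\<^sub>iv\<^sub>i\<close> becomes a ratio after
  division by a fixed square, hence its degree is congruent to \<open>2\<close> modulo \<open>d\<close>
  (\<open>degree_quadratic_pair\<close>); so there is at most one dimension of such sums for each \<open>N\<close> in this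
  class. On the other hand, brackets produce elements of all large degrees congruent to \<open>1\<close> modulo
  \<open>d\<close> (\<open>degrees_eventually_progression\<close>), so each large \<open>N\<close> in the class is a sum of two degrees in
  several ways, and the leading coefficient \<open>ij\<close> of \<open>u'v'\<close> distinguishes them. Hence there are
  more pairs \<open>(\<Sum>u\<^sub>iv\<^sub>i, \<Sum>u\<^sub>i'v\<^sub>i')\<close> than first components, and elimination produces pairs
  \<open>(0, b)\<close> with \<open>b\<close> of arbitrarily large degree (\<open>infinite_degrees_quadratic_kernel\<close>).\<close>

section \<open>Chains of right ideals above an ideal\<close>

text \<open>By the correspondence between right ideals of a quotient and right ideals of the ring above
  \<open>J\<close>, the enveloping algebra can be tested on right ideals of the free algebra.\<close>

lemma right_noetherian_Quot_stabilises:
  assumes J: "ideal J R" and noeth: "right_noetherian (R Quot J)"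
    and right: "\<And>n. right_ideal (I n) R" and mono: "\<And>n :: nat. I n \<subseteq> I (Suc n)"
    and sub: "\<And>n. J \<subseteq> I n"
  shows "\<exists>n. \<forall>m\<ge>n. I m = I n"
proof -
  interpret J: ideal J R by fact
  interpret q: ring_hom_ring R "R Quot J" "(+>\<^bsub>R\<^esub>) J" by (rule J.rcos_ring_hom_ring)
  have add: "additive_subgroup (I n) R" for n
    using right unfolding right_ideal_def by blast
  have carr: "I n \<subseteq> carrier R" for n
    using additive_subgroup.a_subset[OF add] .
  have closed: "y \<otimes>\<^bsub>R\<^esub> r \<in> I n" if "y \<in> I n" "r \<in> carrier R" for y r n
    using right that unfolding right_ideal_def by blast
  let ?I = "\<lambda>n. (+>\<^bsub>R\<^esub>) J ` I n"
  have "right_ideal (?I n) (R Quot J)" for n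
    unfolding right_ideal_def
  proof (intro conjI ballI)
    show "additive_subgroup (?I n) (R Quot J)"
      using group_hom.subgroup_img_is_subgroup[OF q.a_group_hom additive_subgroup.a_subgroup[OF add]]
      by (rule additive_subgroupI)
  next
    fix r a assume "r \<in> carrier (R Quot J)" "a \<in> ?I n"
    then obtain s y where s: "s \<in> carrier R" "r = J +>\<^bsub>R\<^esub> s" and y: "y \<in> I n" "a = J +>\<^bsub>R\<^esub> y"
      unfolding FactRing_def A_RCOSETS_def' partial_object.simps by blast
    have "a \<otimes>\<^bsub>R Quot J\<^esub> r = J +>\<^bsub>R\<^esub> (y \<otimes>\<^bsub>R\<^esub> s)"
      unfolding y(2) s(2) using q.hom_mult[OF subsetD[OF carr y(1)] s(1)] by (rule sym)
    then show "a \<otimes>\<^bsub>R Quot J\<^esub> r \<in> ?I n"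
      using closed[OF y(1) s(1)] by blast
  qed
  moreover have "?I n \<subseteq> ?I (Suc n)" for n
    using mono by blast
  ultimately have "\<exists>n. \<forall>m\<ge>n. ?I m = ?I n"
    using noeth[unfolded right_noetherian_def, THEN spec[of _ ?I]] by blast
  then obtain n where n: "?I m = ?I n" if "m \<ge> n" for m
    by blast
  have "I m = I n" if "m \<ge> n" for m
  proof
    show "I n \<subseteq> I m" using lift_Suc_mono_le[of I, OF mono that] .
    show "I m \<subseteq> I n"
    proof
      fix x assume x: "x \<in> I m"
      have "J +>\<^bsub>R\<^esub> x \<in> ?I n"
        unfolding n[OF that, symmetric] using x by (rule imageI)
      then obtain y where y: "y \<in> I n" "J +>\<^bsub>R\<^esub> x = J +>\<^bsub>R\<^esub> y"
        by (rule imageE)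
      have "x \<in> J +>\<^bsub>R\<^esub> x"
        using x carr J.a_rcos_self by blast
      then obtain h where "h \<in> J" "x = h \<oplus>\<^bsub>R\<^esub> y"
        unfolding y(2) by (auto simp: a_r_coset_def')
      then show "x \<in> I n"
        using sub y(1) additive_subgroup.a_closed[OF add] by blast
    qed
  qed
  then show ?thesis by blast
qed

section \<open>Representations as modules over the free algebra\<close>

text \<open>A representation on \<open>E\<close> of the ambient Lie algebra, of which \<open>L\<close> will be a subalgebra.\<close>

locale lie_representation = vector_space scaleE
  for scaleE :: "'k::field \<Rightarrow> 'e::ab_group_add \<Rightarrow> 'e" (infixr "*e" 75) +
  fixes scale :: "'k \<Rightarrow> 'v::ab_group_add \<Rightarrow> 'v" and br :: "'v \<Rightarrow> 'v \<Rightarrow> 'v"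
    and \<rho> :: "'v \<Rightarrow> 'e \<Rightarrow> 'e"
  assumes rep_add_right: "\<rho> f (a + b) = \<rho> f a + \<rho> f b"
    and rep_scale_right: "\<rho> f (c *e a) = c *e \<rho> f a"
    and rep_add_left: "\<rho> (f + g) a = \<rho> f a + \<rho> g a"
    and rep_scale_left: "\<rho> (scale c f) a = c *e \<rho> f a"
    and rep_br: "\<rho> (br f g) a = \<rho> f (\<rho> g a) - \<rho> g (\<rho> f a)"
begin

abbreviation word_act :: "'v list \<Rightarrow> 'e \<Rightarrow> 'e" where
  "word_act w \<equiv> foldr \<rho> w"

text \<open>A word \<open>[f\<^sub>1, \<dots>, f\<^sub>n]\<close> acts as the composite \<open>\<rho> f\<^sub>1 \<circ> \<dots> \<circ> \<rho> f\<^sub>n\<close>, as for left modules; \<open>act\<close> is the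
  linear extension to noncommutative polynomials.\<close>

definition act :: "('v list \<Rightarrow> 'k) \<Rightarrow> 'e \<Rightarrow> 'e" where
  "act x a = (\<Sum>w | x w \<noteq> 0. x w *e word_act w a)"

lemma word_act_add: "word_act w (a + b) = word_act w a + word_act w b"
  by (induction w) (simp_all add: rep_add_right)

lemma word_act_scale: "word_act w (c *e a) = c *e word_act w a"
  by (induction w) (simp_all add: rep_scale_right)

lemma act_eq_sum:
  assumes "finite S" "{w. x w \<noteq> 0} \<subseteq> S"
  shows "act x a = (\<Sum>w\<in>S. x w *e word_act w a)"
  unfolding act_def using assms by (intro sum.mono_neutral_left) auto

lemma act_word_term: "act (word_term u c) a = c *e word_act u a"
  by (subst act_eq_sum[of "{u}"]) (auto simp: word_term_def)

lemma act_add_left: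
  assumes "x \<in> carrier (free_algebra L)" "y \<in> carrier (free_algebra L)"
  shows "act (\<lambda>w. x w + y w) a = act x a + act y a"
proof -
  let ?S = "{w. x w \<noteq> 0} \<union> {w. y w \<noteq> 0}"
  have fin: "finite ?S" using assms by (simp add: free_algebra_def)
  show ?thesis
    by (subst (1 2 3) act_eq_sum[OF fin]) (auto simp: sum.distrib scale_left_distrib)
qed

lemma act_minus_left:
  assumes "x \<in> carrier (free_algebra L)" "y \<in> carrier (free_algebra L)"
  shows "act (\<lambda>w. x w - y w) a = act x a - act y a"
proof -
  let ?S = "{w. x w \<noteq> 0} \<union> {w. y w \<noteq> 0}"
  have fin: "finite ?S" using assms by (simp add: free_algebra_def)
  show ?thesis
    by (subst (1 2 3) act_eq_sum[OF fin]) (auto simp: sum_subtractf scale_left_diff_distrib)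
qed

lemma act_add: "act x (a + b) = act x a + act x b"
  by (simp add: act_def word_act_add scale_right_distrib sum.distrib)

lemma act_scale: "act x (c *e a) = c *e act x a"
  by (simp add: act_def word_act_scale scale_sum_right mult.commute)

lemma act_zero: "act x 0 = 0"
  using act_scale[of x 0 0] by simp

text \<open>Both sides are sums over pairs of words: a factorization \<open>w = u @ v\<close> is the same as a word \<open>w\<close>
  with a cutting position \<open>i = length u\<close>.\<close>

lemma act_mult:
  assumes x: "x \<in> carrier (free_algebra L)" and y: "y \<in> carrier (free_algebra L)"
  shows "act (x \<otimes>\<^bsub>free_algebra L\<^esub> y) a = act x (act y a)"
proof -
  define A where "A = {w. x w \<noteq> 0}"
  define B where "B = {w. y w \<noteq> 0}"
  define C where "C = (\<lambda>(u, v). u @ v) ` (A \<times> B)"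
  let ?t = "\<lambda>u v. (x u * y v) *e word_act u (word_act v a)"
  have fin: "finite A" "finite B" "finite C"
    using x y by (simp_all add: A_def B_def C_def free_algebra_def)
  have mult: "(x \<otimes>\<^bsub>free_algebra L\<^esub> y) w = (\<Sum>i\<le>length w. x (take i w) * y (drop i w))" for w
    by (simp add: free_algebra_def)
  have "{w. (x \<otimes>\<^bsub>free_algebra L\<^esub> y) w \<noteq> 0} \<subseteq> C"
  proof
    fix w assume "w \<in> {w. (x \<otimes>\<^bsub>free_algebra L\<^esub> y) w \<noteq> 0}"
    then obtain i where "x (take i w) * y (drop i w) \<noteq> 0"
      unfolding mem_Collect_eq mult by (meson sum.not_neutral_contains_not_neutral)
    then have "(take i w, drop i w) \<in> A \<times> B" by (auto simp: A_def B_def)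
    then show "w \<in> C" unfolding C_def by (rule image_eqI[rotated]) simp
  qed
  then have "act (x \<otimes>\<^bsub>free_algebra L\<^esub> y) a
      = (\<Sum>w\<in>C. (x \<otimes>\<^bsub>free_algebra L\<^esub> y) w *e word_act w a)"
    by (rule act_eq_sum[OF fin(3)])
  also have "\<dots> = (\<Sum>w\<in>C. \<Sum>i\<le>length w. ?t (take i w) (drop i w))"
  proof (rule sum.cong[OF refl])
    fix w :: "'v list"
    have *: "word_act w a = word_act (take i w) (word_act (drop i w) a)" for i
      by (metis append_take_drop_id comp_apply foldr_append)
    show "(x \<otimes>\<^bsub>free_algebra L\<^esub> y) w *e word_act w a
        = (\<Sum>i\<le>length w. ?t (take i w) (drop i w))"
      unfolding mult scale_sum_left by (rule sum.cong[OF refl]) (subst *, rule refl)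
  qed
  also have "\<dots> = (\<Sum>(w, i)\<in>(SIGMA w:C. {..length w}). ?t (take i w) (drop i w))"
    by (rule sum.Sigma) (use fin in auto)
  also have "\<dots> = (\<Sum>(u, v)\<in>A \<times> B. ?t u v)"
  proof -
    let ?S = "{(w, i) \<in> SIGMA w:C. {..length w}. take i w \<in> A \<and> drop i w \<in> B}"
    have C: "u @ v \<in> C" if "u \<in> A" "v \<in> B" for u v
      using that unfolding C_def by force
    have "(\<Sum>(w, i)\<in>(SIGMA w:C. {..length w}). ?t (take i w) (drop i w))
        = (\<Sum>(w, i)\<in>?S. ?t (take i w) (drop i w))"
      by (rule sum.mono_neutral_right) (use fin in \<open>auto simp: A_def B_def\<close>)
    also have "\<dots> = (\<Sum>(u, v)\<in>A \<times> B. ?t u v)"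
      by (rule sum.reindex_bij_witness[of _ "\<lambda>(u, v). (u @ v, length u)"
            "\<lambda>(w, i). (take i w, drop i w)"]) (use C in auto)
    finally show ?thesis .
  qed
  also have "\<dots> = (\<Sum>u\<in>A. \<Sum>v\<in>B. ?t u v)"
    by (rule sum.cartesian_product[symmetric])
  also have "\<dots> = act x (act y a)"
  proof -
    have "word_act u (act y a) = (\<Sum>v\<in>B. y v *e word_act u (word_act v a))" for u
    proof -
      interpret additive "word_act u" by standard (rule word_act_add)
      show ?thesis by (simp add: act_def B_def sum word_act_scale)
    qed
    then show ?thesis
      by (simp add: act_def[of x] A_def scale_sum_right)
  qed
  finally show ?thesis .
qed

text \<open>The action descends to the enveloping algebra: the elements acting as zero form an ideal, and
  the axioms of a representation say that it contains the relations.\<close>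

lemma act_enveloping_ideal:
  assumes "Modules.module scale" "lie_subalgebra scale br L"
    and x: "x \<in> Idl\<^bsub>free_algebra L\<^esub> (enveloping_relations scale br L)"
  shows "act x a = 0"
proof -
  let ?F = "free_algebra L :: ('v list \<Rightarrow> 'k) ring"
  interpret F: ring ?F by (rule free_algebra_ring)
  define N where "N = {x \<in> carrier ?F. \<forall>a. act x a = 0}"
  have act_plus: "act (x \<oplus>\<^bsub>?F\<^esub> y) a = act x a + act y a"
    if "x \<in> carrier ?F" "y \<in> carrier ?F" for x y a
    using act_add_left[OF that] by (simp add: free_algebra_def)
  have "ideal N ?F"
  proof (rule idealI)
    show "ring ?F" by (rule free_algebra_ring)
    show "subgroup N (add_monoid ?F)"
    proof (rule F.add.subgroupI)
      have "act \<zero>\<^bsub>?F\<^esub> a = 0" for a by (simp add: free_algebra_def act_def)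
      then show "N \<noteq> {}" unfolding N_def by blast
      fix x assume x: "x \<in> N"
      then have "act (\<ominus>\<^bsub>?F\<^esub> x) a = 0" for a
        using act_plus[of x "\<ominus>\<^bsub>?F\<^esub> x" a] \<open>act \<zero>\<^bsub>?F\<^esub> a = 0\<close>
        by (simp add: N_def F.r_neg)
      with x show "\<ominus>\<^bsub>?F\<^esub> x \<in> N" by (simp add: N_def)
    qed (auto simp: N_def act_plus)
  qed (auto simp: N_def act_mult act_zero)
  moreover have "enveloping_relations scale br L \<subseteq> N"
  proof
    fix r assume r: "r \<in> enveloping_relations scale br L"
    have carr: "r \<in> carrier ?F"
      using enveloping_relations_carrier[OF assms(1,2)] r by blast
    have carr_word: "word_term u c \<in> carrier (free_algebra UNIV)" for u :: "'v list" and c :: 'k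
      by (rule word_term_carrier) simp
    have "act r a = 0" for a
      using r unfolding enveloping_relations_def
      by (auto simp: act_minus_left[where L = UNIV] carr_word free_algebra_minus_closed act_word_term
          rep_add_left rep_scale_left rep_br)
    with carr show "r \<in> N" by (simp add: N_def)
  qed
  ultimately have "Idl\<^bsub>?F\<^esub> (enveloping_relations scale br L) \<subseteq> N"
    by (rule F.genideal_minimal)
  with x show ?thesis by (auto simp: N_def)
qed

end

section \<open>A criterion for failure of the right noetherian property\<close>

text \<open>Let \<open>P\<close> be the annihilator of \<open>M\<close>. Since \<open>L\<close> maps \<open>e\<close> into the submodule \<open>M\<close>, every \<open>y\<close> sends \<open>e\<close>
  to \<open>c e\<close> modulo \<open>M\<close> for some scalar \<open>c\<close>, so \<open>x y e = c (x e)\<close> for \<open>x \<in> P\<close>. Right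
  multiplication therefore only rescales \<open>x e\<close>, and for each subspace \<open>W\<close> of \<open>E\<close> the set of all
  \<open>x \<in> P\<close> with \<open>x e \<in> W\<close> is a right ideal. If a chain of subspaces keeps
  catching new vectors of \<open>P e\<close>, then these right ideals do not stabilise.\<close>

lemma (in lie_representation) not_right_noetherianI:
  assumes L: "Modules.module scale" "lie_subalgebra scale br L"
    and M: "subspace M" "\<And>f a. f \<in> L \<Longrightarrow> a \<in> M \<Longrightarrow> \<rho> f a \<in> M"
    and e: "\<And>f. f \<in> L \<Longrightarrow> \<rho> f e \<in> M"
    and W: "\<And>n :: nat. subspace (W n)" "\<And>n. W n \<subseteq> W (Suc n)"
    and unbounded: "\<And>n. \<exists>x\<in>carrier (free_algebra L).
        (\<forall>a\<in>M. act x a = 0) \<and> act x e \<notin> W n \<and> (\<exists>m. act x e \<in> W m)"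
  shows "\<not> right_noetherian (universal_enveloping_algebra scale br L)"
proof
  let ?F = "free_algebra L :: ('v list \<Rightarrow> 'k) ring"
  let ?J = "Idl\<^bsub>?F\<^esub> (enveloping_relations scale br L)"
  assume "right_noetherian (universal_enveloping_algebra scale br L)"
  then have noeth: "right_noetherian (?F Quot ?J)"
    unfolding universal_enveloping_algebra_def .
  interpret F: ring ?F by (rule free_algebra_ring)
  have J: "ideal ?J ?F"
    by (rule F.genideal_ideal[OF enveloping_relations_carrier[OF L]])
  define I where "I n = {x \<in> carrier ?F. (\<forall>a\<in>M. act x a = 0) \<and> act x e \<in> W n}" for n
  have act_plus: "act (x \<oplus>\<^bsub>?F\<^esub> y) a = act x a + act y a"
    if "x \<in> carrier ?F" "y \<in> carrier ?F" for x y a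
    using act_add_left[OF that] by (simp add: free_algebra_def)
  have act_0: "act \<zero>\<^bsub>?F\<^esub> a = 0" for a by (simp add: free_algebra_def act_def)
  have act_uminus: "act (\<ominus>\<^bsub>?F\<^esub> x) a = - act x a" if "x \<in> carrier ?F" for x a
    using act_plus[of x "\<ominus>\<^bsub>?F\<^esub> x" a] that act_0 by (simp add: F.r_neg add_eq_0_iff)
  have word_M: "word_act w a \<in> M" if "set w \<subseteq> L" "a \<in> M" for w a
    using that by (induction w) (auto intro: M)
  have word_e: "word_act w e \<in> span (insert e M)" if "set w \<subseteq> L" for w
  proof (cases w)
    case (Cons f v)
    have "word_act v e \<in> insert e M" if "set v \<subseteq> L" for v
      using that by (induction v) (auto intro: M e)
    with Cons that have "f \<in> L" "word_act v e \<in> insert e M" by auto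
    then have "word_act w e \<in> M" using Cons by (auto intro: M e)
    then show ?thesis by (simp add: span_base)
  qed (simp add: span_base)
  have act_M: "act y a \<in> M" if "y \<in> carrier ?F" "a \<in> M" for y a
    using that unfolding act_def
    by (intro subspace_sum M subspace_scale word_M) (auto simp: free_algebra_def)
  have act_e: "\<exists>c. act y e - c *e e \<in> M" if "y \<in> carrier ?F" for y
  proof -
    have "act y e \<in> span (insert e M)"
      using that unfolding act_def
      by (intro span_sum span_scale word_e) (auto simp: free_algebra_def)
    then show ?thesis using M(1) by (metis span_breakdown_eq span_eq_iff)
  qed
  have right: "right_ideal (I n) ?F" for n
    unfolding right_ideal_def
  proof (intro conjI ballI)
    show "additive_subgroup (I n) ?F"
    proof (rule additive_subgroupI, rule F.add.subgroupI)
      show "I n \<noteq> {}"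
        using act_0 W(1) by (auto simp: I_def intro!: exI[of _ "\<zero>\<^bsub>?F\<^esub>"] subspace_0)
      show "\<ominus>\<^bsub>?F\<^esub> x \<in> I n" if "x \<in> I n" for x
        using that W(1) by (auto simp: I_def act_uminus intro!: subspace_neg)
      show "x \<oplus>\<^bsub>?F\<^esub> y \<in> I n" if "x \<in> I n" "y \<in> I n" for x y
        using that W(1) by (auto simp: I_def act_plus intro!: subspace_add)
    qed (auto simp: I_def)
  next
    fix y x assume y: "y \<in> carrier ?F" and "x \<in> I n"
    then have x: "x \<in> carrier ?F" "\<And>a. a \<in> M \<Longrightarrow> act x a = 0" "act x e \<in> W n"
      by (auto simp: I_def)
    obtain c where c: "act y e - c *e e \<in> M" using act_e[OF y] by blast
    have "act x (act y e) = act x ((act y e - c *e e) + c *e e)" by simp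
    also have "\<dots> = c *e act x e"
      unfolding act_add act_scale using x(2)[OF c] by simp
    finally have "act (x \<otimes>\<^bsub>?F\<^esub> y) e \<in> W n"
      using act_mult[OF x(1) y] x(3) W(1) by (simp add: subspace_scale)
    then show "x \<otimes>\<^bsub>?F\<^esub> y \<in> I n"
      using x y act_mult[OF x(1) y] act_M[OF y] by (auto simp: I_def)
  qed
  have "\<exists>n. \<forall>m\<ge>n. I m = I n"
  proof (rule right_noetherian_Quot_stabilises[OF J noeth right])
    show "I n \<subseteq> I (Suc n)" for n
      using W(2) by (auto simp: I_def)
    show "?J \<subseteq> I n" for n
      using act_enveloping_ideal[OF L] ideal.Icarr[OF J] W(1)
      by (auto simp: I_def subspace_0)
  qed
  then obtain n where n: "\<And>m. m \<ge> n \<Longrightarrow> I m = I n" by blast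
  obtain x m where x: "x \<in> carrier ?F" "\<forall>a\<in>M. act x a = 0" "act x e \<notin> W n" "act x e \<in> W m"
    using unbounded[of n] by blast
  have "W m \<subseteq> W (max m n)"
    by (rule lift_Suc_mono_le[of W, OF W(2)]) simp
  with x have "x \<in> I (max m n)" by (auto simp: I_def)
  with n[of "max m n"] x(3) show False by (auto simp: I_def)
qed

section \<open>The extension defined by the divergence cocycle\<close>

definition scale_pair :: "'k::field_char_0 \<Rightarrow> 'k poly \<times> 'k \<Rightarrow> 'k poly \<times> 'k" where
  "scale_pair c a = (Polynomial.smult c (fst a), c * snd a)"

text \<open>The map sending \<open>f\<partial>\<close> to its divergence \<open>f'\<close> is a 1-cocycle of the Lie algebra of derivations
  with values in \<open>k[t]\<close>. It defines an extension of the trivial module by \<open>k[t]\<close>, realised here on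
  pairs, with \<open>f\<partial>\<close> acting by \<open>(p, c) \<mapsto> (f p' + c f', 0)\<close>. The submodule is the set of pairs
  \<open>(p, 0)\<close>, and the vector outside it used below is \<open>(0, 1)\<close>.\<close>

definition divergence_rep :: "'k::field_char_0 poly \<Rightarrow> 'k poly \<times> 'k \<Rightarrow> 'k poly \<times> 'k" where
  "divergence_rep f a = (f * pderiv (fst a) + Polynomial.smult (snd a) (pderiv f), 0)"

interpretation divergence: lie_representation scale_pair Polynomial.smult W_bracket divergence_rep
proof
qed (auto simp: scale_pair_def divergence_rep_def W_bracket_def prod_eq_iff algebra_simps
      smult_add_right smult_add_left smult_diff_right pderiv_add pderiv_smult pderiv_mult pderiv_diff)

text \<open>The set of all pairs \<open>(\<Sum>u\<^sub>iv\<^sub>i, \<Sum>u\<^sub>i'v\<^sub>i')\<close>, that is, the image of the symmetric square of \<open>L\<close>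
  under the multiplication map and its analogue for derivatives. Scalars can be absorbed into the
  factors when \<open>L\<close> is a subspace.\<close>

inductive_set quadratic_pairs :: "'k::field_char_0 poly set \<Rightarrow> ('k poly \<times> 'k poly) set"
  for L where
  zero: "(0, 0) \<in> quadratic_pairs L"
| add: "u \<in> L \<Longrightarrow> v \<in> L \<Longrightarrow> (a, b) \<in> quadratic_pairs L \<Longrightarrow>
    (a + u * v, b + pderiv u * pderiv v) \<in> quadratic_pairs L"

text \<open>The symmetrised element \<open>x = \<Sum>(u\<^sub>iv\<^sub>i + v\<^sub>iu\<^sub>i)\<close> acts on \<open>k[t]\<close> by \<open>2a\<partial>\<^sup>2 + a'\<partial>\<close>, which sees only
  the product \<open>a = \<Sum>u\<^sub>iv\<^sub>i\<close>, while its value at \<open>(0, 1)\<close> also involves \<open>b = \<Sum>u\<^sub>i'v\<^sub>i'\<close>. Thus a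
  relation \<open>a = 0\<close> produces an element that annihilates \<open>k[t]\<close> and sends \<open>(0, 1)\<close> to \<open>-2b\<close>.\<close>

lemma quadratic_pairs_act:
  assumes "(a, b) \<in> quadratic_pairs L"
  shows "\<exists>x\<in>carrier (free_algebra L). \<forall>p c.
    divergence.act x (p, c) = (2 * a * pderiv (pderiv p) + pderiv a * pderiv p
      + Polynomial.smult c (pderiv (pderiv a) - 2 * b), 0)"
  using assms
proof induction
  case zero
  show ?case
    by (rule bexI[of _ "\<lambda>w. 0"]) (auto simp: divergence.act_def free_algebra_def zero_prod_def)
next
  case (add u v a b)
  then obtain x where x: "x \<in> carrier (free_algebra L)"
    "\<And>p c. divergence.act x (p, c) = (2 * a * pderiv (pderiv p) + pderiv a * pderiv p
      + Polynomial.smult c (pderiv (pderiv a) - 2 * b), 0)"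
    by blast
  interpret F: ring "free_algebra L :: ('a poly list \<Rightarrow> 'a) ring" by (rule free_algebra_ring)
  let ?q = "\<lambda>w. word_term [u, v] 1 w + word_term [v, u] (1::'a) w"
  have uv: "word_term [u, v] 1 \<in> carrier (free_algebra L)"
    "word_term [v, u] (1::'a) \<in> carrier (free_algebra L)"
    using add by (auto intro!: word_term_carrier)
  have q: "?q \<in> carrier (free_algebra L)"
    using F.a_closed[OF uv] by (simp add: free_algebra_def)
  have xq: "(\<lambda>w. x w + ?q w) \<in> carrier (free_algebra L)"
    using F.a_closed[OF x(1) q] by (simp add: free_algebra_def)
  show ?case
  proof (rule bexI[OF _ xq], intro allI)
    fix p c
    show "divergence.act (\<lambda>w. x w + ?q w) (p, c) =
      (2 * (a + u * v) * pderiv (pderiv p) + pderiv (a + u * v) * pderiv p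
      + Polynomial.smult c (pderiv (pderiv (a + u * v)) - 2 * (b + pderiv u * pderiv v)), 0)"
      unfolding divergence.act_add_left[OF x(1) q] divergence.act_add_left[OF uv] divergence.act_word_term x(2)
      by (simp add: scale_pair_def divergence_rep_def pderiv_add pderiv_mult pderiv_smult algebra_simps
          smult_add_right smult_diff_right prod_eq_iff)
  qed
qed

lemma not_right_noetherian_if_quadratic_pairs:
  assumes L: "lie_subalgebra Polynomial.smult W_bracket L"
    and inf: "infinite {degree b | b. (0, b) \<in> quadratic_pairs L}"
  shows "\<not> right_noetherian (universal_enveloping_algebra Polynomial.smult W_bracket L)"
proof (rule divergence.not_right_noetherianI[OF module_poly L, where M = "{a. snd a = 0}" and e = "(0, 1)"
      and W = "\<lambda>n. {a. degree (fst a) \<le> n}"])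
  show "divergence.subspace {a. snd a = (0 :: 'a)}"
    by (rule divergence.subspaceI) (auto simp: scale_pair_def)
  show "divergence.subspace {a :: 'a poly \<times> 'a. degree (fst a) \<le> n}" for n
    by (rule divergence.subspaceI) (auto simp: scale_pair_def intro: degree_add_le order.trans[OF degree_smult_le])
  fix n
  obtain b where b: "(0, b) \<in> quadratic_pairs L" "degree b > n"
    using infinite_nat_iff_unbounded[THEN iffD1, OF inf] by auto
  obtain x where x: "x \<in> carrier (free_algebra L)"
    "\<And>p c. divergence.act x (p, c) = (Polynomial.smult c (- 2 * b), 0)"
    using quadratic_pairs_act[OF b(1)] by auto
  have "degree (2 * b) = degree b"
    by (cases "b = 0") (simp_all add: degree_mult_eq)
  with x b(2) show "\<exists>x\<in>carrier (free_algebra L). (\<forall>a\<in>{a. snd a = 0}. divergence.act x a = 0) \<and>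
        divergence.act x (0, 1) \<notin> {a. degree (fst a) \<le> n} \<and>
        (\<exists>m. divergence.act x (0, 1) \<in> {a. degree (fst a) \<le> m})"
    by (intro bexI[OF _ x(1)]) (auto simp: zero_prod_def)
qed (auto simp: divergence_rep_def)

section \<open>Degrees in a Lie algebra of polynomial vector fields\<close>

lemma coeff_mult_pderiv_top:
  fixes f g :: "'k::field_char_0 poly"
  assumes "degree f + degree g > 0"
  shows "coeff (f * pderiv g) (degree f + degree g - 1) = of_nat (degree g) * (lead_coeff f * lead_coeff g)"
proof (cases "degree g = 0")
  case True
  then show ?thesis by (metis pderiv_eq_0_iff mult_zero_right coeff_0 of_nat_0 mult_zero_left)
next
  case False
  then have "degree f + degree g - 1 = degree f + degree (pderiv g)"
    by (simp add: degree_pderiv)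
  then show ?thesis
    using False by (simp only: coeff_mult_degree_sum) (simp add: degree_pderiv coeff_pderiv)
qed

lemma degree_W_bracket:
  fixes f g :: "'k::field_char_0 poly"
  assumes "f \<noteq> 0" "g \<noteq> 0" "degree f \<noteq> degree g"
  shows "W_bracket f g \<noteq> 0" "degree (W_bracket f g) = degree f + degree g - 1"
proof -
  let ?N = "degree f + degree g - 1"
  have pos: "degree f + degree g > 0" "degree g + degree f > 0" using assms(3) by auto
  have "coeff (W_bracket f g) ?N = (of_nat (degree g) - of_nat (degree f)) * (lead_coeff f * lead_coeff g)"
    using coeff_mult_pderiv_top[of f g] coeff_mult_pderiv_top[of g f] pos
    by (simp add: W_bracket_def algebra_simps)
  then have ne: "coeff (W_bracket f g) ?N \<noteq> 0"
    using assms by simp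
  then show "W_bracket f g \<noteq> 0" by auto
  have *: "degree (p * pderiv q) \<le> degree p + degree q - 1" for p q :: "'k poly"
  proof (cases "degree q = 0")
    case True
    then have "pderiv q = 0" by (simp add: pderiv_eq_0_iff)
    then show ?thesis by simp
  next
    case False
    then show ?thesis using degree_mult_le[of p "pderiv q"] by (simp add: degree_pderiv)
  qed
  have "degree (W_bracket f g) \<le> ?N"
    unfolding W_bracket_def
    by (rule degree_diff_le) (use *[of f g] *[of g f] in \<open>simp_all add: ac_simps\<close>)
  then show "degree (W_bracket f g) = ?N"
    using le_degree[OF ne] by simp
qed

lemma infinite_degrees:
  fixes L :: "'k::field_char_0 poly set"
  assumes L: "module.subspace Polynomial.smult L" and inf: "infinite_dimensional Polynomial.smult L"
  shows "infinite (degree ` (L - {0}))"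
proof
  assume "finite (degree ` (L - {0}))"
  then obtain n where n: "\<And>f. f \<in> L - {0} \<Longrightarrow> degree f \<le> n"
    by (auto simp: finite_nat_set_iff_bounded_le)
  interpret P: vector_space "Polynomial.smult :: 'k \<Rightarrow> 'k poly \<Rightarrow> 'k poly"
    by standard (simp_all add: smult_add_left smult_add_right)
  let ?T = "(\<lambda>i. monom (1::'k) i) ` {..n}"
  have sub: "L \<subseteq> P.span ?T"
  proof
    fix f assume "f \<in> L"
    then have "degree f \<le> n" using n by (cases "f = 0") auto
    then have "f = (\<Sum>i\<le>n. monom (coeff f i) i)" by (metis poly_as_sum_of_monoms')
    also have "\<dots> = (\<Sum>i\<le>n. Polynomial.smult (coeff f i) (monom 1 i))"
      by (simp add: smult_monom)
    also have "\<dots> \<in> P.span ?T"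
      by (intro P.span_sum P.span_scale P.span_base) auto
    finally show "f \<in> P.span ?T" .
  qed
  obtain B where B: "B \<subseteq> L" "P.independent B" "L \<subseteq> P.span B"
    by (rule P.basis_exists)
  have "finite B"
    using P.independent_span_bound[OF _ B(2), of ?T] B(1) sub by auto
  moreover have "P.span B = L" using B(1,3) L by (rule P.span_subspace)
  ultimately show False using inf unfolding infinite_dimensional_def by blast
qed

lemma int_subgroup_eq_multiples:
  fixes D :: "int set"
  assumes diff: "\<And>x y. x \<in> D \<Longrightarrow> y \<in> D \<Longrightarrow> x - y \<in> D" and "d \<in> D" "d \<noteq> 0"
  obtains e where "e > 0" "D = range ((*) e)"
proof -
  have 0: "0 \<in> D" using diff[OF \<open>d \<in> D\<close> \<open>d \<in> D\<close>] by simp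
  have neg: "- x \<in> D" if "x \<in> D" for x using diff[OF 0 that] by simp
  have add: "x + y \<in> D" if "x \<in> D" "y \<in> D" for x y using diff[OF that(1) neg[OF that(2)]] by simp
  define e where "e = (LEAST n::nat. n > 0 \<and> int n \<in> D)"
  have "\<exists>n::nat. n > 0 \<and> int n \<in> D"
    using \<open>d \<in> D\<close> \<open>d \<noteq> 0\<close> neg[of d] by (intro exI[of _ "nat \<bar>d\<bar>"]) (auto simp: abs_if)
  then have e: "e > 0" "int e \<in> D"
    using LeastI_ex[of "\<lambda>n::nat. n > 0 \<and> int n \<in> D"] unfolding e_def by auto
  have nmult: "int e * int k \<in> D" for k
    by (induction k) (auto simp: 0 algebra_simps intro: add e)
  have mult: "int e * k \<in> D" for k
    using nmult[of "nat k"] neg[OF nmult[of "nat (- k)"]] by (cases "k \<ge> 0") auto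
  have "x \<in> range ((*) (int e))" if "x \<in> D" for x
  proof -
    have "x mod int e = x - int e * (x div int e)" by (simp add: minus_mult_div_eq_mod)
    then have "x mod int e \<in> D" using diff[OF that mult] by simp
    then have "int (nat (x mod int e)) \<in> D" using e(1) by simp
    then have "nat (x mod int e) = 0"
      using not_less_Least[of "nat (x mod int e)" "\<lambda>n::nat. n > 0 \<and> int n \<in> D"] e(1)
        pos_mod_bound[of "int e" x]
      unfolding e_def[symmetric] by (auto simp: nat_less_iff)
    then have "x mod int e = 0" using e(1) pos_mod_sign[of "int e" x] by linarith
    then show ?thesis by (metis dvd_def mod_0_imp_dvd rangeI)
  qed
  with mult have "D = range ((*) (int e))" by auto
  with e(1) show thesis by (intro that[of "int e"]) auto
qed

text \<open>The restriction to distinct summands reflects the bracket, which loses its leading term on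
  elements of equal degree. It is circumvented by first moving \<open>\<alpha>\<close> and \<open>\<alpha> + 1\<close> to consecutive
  positive elements \<open>b\<close> and \<open>b + 1\<close>: adding \<open>b\<close> repeatedly to \<open>b + 1\<close>, and then \<open>b + 1\<close>, never meets
  equal summands, and the sums \<open>k b + l (b + 1)\<close> with \<open>k, l \<ge> 1\<close> cover all large integers.\<close>

lemma distinct_sum_closed_eventually_all:
  fixes A :: "int set"
  assumes add: "\<And>x y. x \<in> A \<Longrightarrow> y \<in> A \<Longrightarrow> x \<noteq> y \<Longrightarrow> x + y \<in> A"
    and \<alpha>: "\<alpha> \<in> A" "\<alpha> + 1 \<in> A" and unbounded: "\<And>n. \<exists>a\<in>A. a > n"
  shows "\<exists>n. \<forall>a\<ge>n. a \<in> A"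
proof -
  obtain c where c: "c \<in> A" "c > \<bar>\<alpha>\<bar> + 1" using unbounded by blast
  define b where "b = c + \<alpha>"
  have b: "b \<in> A" "b + 1 \<in> A" "b > 1"
    using add[OF c(1) \<alpha>(1)] add[OF c(1) \<alpha>(2)] c(2) by (auto simp: b_def algebra_simps)
  have 1: "b + 1 + int k * b \<in> A" for k
  proof (induction k)
    case (Suc k)
    have "int k * b \<ge> 0" using b(3) by simp
    then show ?case using add[OF Suc b(1)] by (simp add: algebra_simps)
  qed (use b in simp)
  have 2: "(int l + 1) * (b + 1) + (int k + 1) * b \<in> A" for k l
  proof (induction l)
    case 0
    show ?case using 1[of "Suc k"] by (simp add: algebra_simps)
  next
    case (Suc l)
    have "1 * (b + 1) \<le> (int l + 1) * (b + 1)" by (rule mult_right_mono) (use b(3) in auto)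
    moreover have "(int k + 1) * b > 0" using b(3) by simp
    ultimately have "(int l + 1) * (b + 1) + (int k + 1) * b > b + 1" by simp
    then show ?case using add[OF Suc b(2)] by (simp add: algebra_simps)
  qed
  have "a \<in> A" if "a \<ge> b * (b + 1) + b" for a
  proof -
    \<comment> \<open>Writing \<open>a = (l + 1)(b + 1) + (k + 1) b = (k + l + 2) b + (l + 1)\<close> determines \<open>l\<close> and
      \<open>k\<close> by division of \<open>a - 1\<close> by \<open>b\<close>.\<close>
    define l where "l = (a - 1) mod b"
    define k where "k = (a - 1) div b - l - 2"
    have l: "0 \<le> l" "l < b" using b(3) by (simp_all add: l_def)
    have a: "a = b * ((a - 1) div b) + l + 1" unfolding l_def by (simp add: algebra_simps)
    have "(a - 1) div b \<ge> b + 1"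
      using zdiv_mono1[of "(b + 1) * b" "a - 1" b] that b(3) by (simp add: algebra_simps)
    then have "k \<ge> 0" using l by (simp add: k_def)
    have "(int (nat l) + 1) * (b + 1) + (int (nat k) + 1) * b = a"
      using l \<open>k \<ge> 0\<close> a by (simp add: k_def algebra_simps)
    then show ?thesis using 2[of "nat l" "nat k"] by simp
  qed
  then show ?thesis by blast
qed

section \<open>Elimination in spaces of pairs of polynomials\<close>

lemma quadratic_pairs_add:
  "(a, b) \<in> quadratic_pairs L \<Longrightarrow> (a', b') \<in> quadratic_pairs L \<Longrightarrow>
    (a + a', b + b') \<in> quadratic_pairs L"
proof (induction a b rule: quadratic_pairs.induct)
  case (add u v a b)
  from quadratic_pairs.add[OF add(1,2) add.IH[OF add.prems]] show ?case
    by (simp add: algebra_simps)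
qed simp

lemma quadratic_pairs_smult:
  assumes L: "module.subspace Polynomial.smult L"
  shows "(a, b) \<in> quadratic_pairs L \<Longrightarrow>
    (Polynomial.smult c a, Polynomial.smult c b) \<in> quadratic_pairs L"
proof (induction a b rule: quadratic_pairs.induct)
  case (add u v a b)
  from quadratic_pairs.add[OF module.subspace_scale[OF module_poly L add(1), of c] add(2) add.IH]
  show ?case by (simp add: smult_add_right pderiv_smult)
qed (simp add: quadratic_pairs.zero)

lemma quadratic_pairs_diff:
  assumes L: "module.subspace Polynomial.smult L"
    and "(a, b) \<in> quadratic_pairs L" "(a', b') \<in> quadratic_pairs L"
  shows "(a - Polynomial.smult c a', b - Polynomial.smult c b') \<in> quadratic_pairs L"
  using quadratic_pairs_add[OF assms(2) quadratic_pairs_smult[OF L assms(3), of "- c"]] by simp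

lemma quadratic_pairs_mult:
  "u \<in> L \<Longrightarrow> v \<in> L \<Longrightarrow> (u * v, pderiv u * pderiv v) \<in> quadratic_pairs L"
  using quadratic_pairs.add[OF _ _ quadratic_pairs.zero] by simp

text \<open>Gaussian elimination: if the first components are confined to a space of finite dimension, one
  can clear them one coefficient at a time. Clearing with the pair whose second component has the
  least degree keeps all larger degrees of second components.\<close>

lemma infinite_degrees_kernel:
  fixes G :: "('k::field poly \<times> 'k poly) set"
  assumes diff: "\<And>a b a' b' c. (a, b) \<in> G \<Longrightarrow> (a', b') \<in> G \<Longrightarrow>
      (a - Polynomial.smult c a', b - Polynomial.smult c b') \<in> G"
  shows "infinite {degree b | a b. (a, b) \<in> G \<and> (\<forall>i\<ge>m. coeff a i = 0)} \<Longrightarrow>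
    infinite {degree b | b. (0, b) \<in> G}"
proof (induction m)
  case 0
  have "{degree b | a b. (a, b) \<in> G \<and> (\<forall>i\<ge>0. coeff a i = 0)} \<subseteq> {degree b | b. (0, b) \<in> G}"
  proof clarify
    fix a b assume "(a, b) \<in> G" "\<forall>i\<ge>0. coeff a i = 0"
    moreover from this have "a = 0" by (simp add: poly_eq_iff)
    ultimately show "\<exists>b'. degree b = degree b' \<and> (0, b') \<in> G" by blast
  qed
  with 0 show ?case by (rule infinite_super[rotated])
next
  case (Suc m)
  let ?T = "\<lambda>m. {degree b | a b. (a, b) \<in> G \<and> (\<forall>i\<ge>m. coeff a i = 0)}"
  show ?case
  proof (rule Suc.IH, rule ccontr)
    assume "\<not> infinite (?T m)"
    with Suc.prems have inf: "infinite (?T (Suc m) - ?T m)" by simp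
    then have "?T (Suc m) - ?T m \<noteq> {}" by (metis finite.emptyI)
    then obtain n\<^sub>1 where n\<^sub>1: "n\<^sub>1 \<in> ?T (Suc m)" "n\<^sub>1 \<notin> ?T m" by blast
    from n\<^sub>1(1) obtain a\<^sub>1 b\<^sub>1 where 1: "(a\<^sub>1, b\<^sub>1) \<in> G" "\<forall>i\<ge>Suc m. coeff a\<^sub>1 i = 0" "n\<^sub>1 = degree b\<^sub>1"
      by blast
    have "coeff a\<^sub>1 m \<noteq> 0"
    proof
      assume "coeff a\<^sub>1 m = 0"
      with 1(2) have "\<forall>i\<ge>m. coeff a\<^sub>1 i = 0" by (metis Suc_leI le_neq_implies_less)
      with 1 n\<^sub>1(2) show False by blast
    qed
    have "?T (Suc m) - ?T m \<subseteq> {..n\<^sub>1}"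
    proof
      fix n assume "n \<in> ?T (Suc m) - ?T m"
      then have n: "n \<in> ?T (Suc m)" "n \<notin> ?T m" by simp_all
      from n(1) obtain a b where 2: "(a, b) \<in> G" "\<forall>i\<ge>Suc m. coeff a i = 0" "n = degree b"
        by blast
      show "n \<in> {..n\<^sub>1}"
      proof (rule ccontr)
        assume "n \<notin> {..n\<^sub>1}"
        define c where "c = coeff a m / coeff a\<^sub>1 m"
        let ?a = "a - Polynomial.smult c a\<^sub>1" and ?b = "b - Polynomial.smult c b\<^sub>1"
        have "(?a, ?b) \<in> G" by (rule diff[OF 2(1) 1(1)])
        moreover have "coeff ?a i = 0" if "i \<ge> m" for i
          using 1(2) 2(2) that \<open>coeff a\<^sub>1 m \<noteq> 0\<close> by (cases "i = m") (auto simp: c_def)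
        moreover have "degree (Polynomial.smult c b\<^sub>1) < degree b"
          using degree_smult_le[of c b\<^sub>1] 1(3) 2(3) \<open>n \<notin> {..n\<^sub>1}\<close> by simp
        then have "degree ?b = n"
          using degree_add_eq_left[of "- Polynomial.smult c b\<^sub>1" b] 2(3) by simp
        ultimately have "n \<in> ?T m" by blast
        with n(2) show False ..
      qed
    qed
    with inf show False by (meson finite_atMost finite_subset)
  qed
qed

section \<open>Degrees when the ratios form a field\<close>

text \<open>The degrees of the nonzero elements of \<open>ratios L\<close>; for a field of ratios this is the value group
  of the place at infinity.\<close>

definition degree_diffs :: "'k::field_char_0 poly set \<Rightarrow> int set" where
  "degree_diffs L = {int (degree w) - int (degree u) | w u. w \<in> L - {0} \<and> u \<in> L - {0}}"

lemma degree_Fract_in_ratios: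
  assumes "Fract p q \<in> ratios L" "p \<noteq> 0" "q \<noteq> 0"
  shows "int (degree p) - int (degree q) \<in> degree_diffs L"
proof -
  obtain w u where wu: "Fract p q = Fract w u" "w \<in> L" "u \<in> L" "u \<noteq> 0"
    using assms(1) by (auto simp: ratios_def)
  then have eq: "p * u = w * q" using assms(3) by (simp add: eq_fract)
  with assms wu have "w \<noteq> 0" by auto
  then have "degree p + degree u = degree w + degree q"
    using eq assms wu(4) by (metis degree_mult_eq)
  then have "int (degree p) - int (degree q) = int (degree w) - int (degree u)" by simp
  with wu \<open>w \<noteq> 0\<close> show ?thesis unfolding degree_diffs_def by blast
qed

locale lie_subalgebra_ratio_field =
  fixes L :: "'k::field_char_0 poly set"
  assumes L: "lie_subalgebra Polynomial.smult W_bracket L"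
    and infdim: "infinite_dimensional Polynomial.smult L"
    and ratio_field: "subfield (ratios L) (ring_of_type_algebra :: 'k poly fract ring)"
begin

lemma subspace: "module.subspace Polynomial.smult L"
  using L unfolding lie_subalgebra_def by blast

lemma ratios_mult: "x \<in> ratios L \<Longrightarrow> y \<in> ratios L \<Longrightarrow> x * y \<in> ratios L"
  and ratios_add: "x \<in> ratios L \<Longrightarrow> y \<in> ratios L \<Longrightarrow> x + y \<in> ratios L"
  and ratios_0: "0 \<in> ratios L"
proof -
  interpret subfield "ratios L" "ring_of_type_algebra :: 'k poly fract ring" by (rule ratio_field)
  have sr: "subring (ratios L) (ring_of_type_algebra :: 'k poly fract ring)" by (rule subring_axioms)
  show "x \<in> ratios L \<Longrightarrow> y \<in> ratios L \<Longrightarrow> x * y \<in> ratios L"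
    using subringE(6)[OF sr] by (simp add: ring_of_type_algebra_def)
  show "x \<in> ratios L \<Longrightarrow> y \<in> ratios L \<Longrightarrow> x + y \<in> ratios L"
    using subringE(7)[OF sr] by (simp add: ring_of_type_algebra_def)
  show "0 \<in> ratios L"
    using subringE(2)[OF sr] by (simp add: ring_of_type_algebra_def)
qed

lemma degree_diffs_add:
  assumes "x \<in> degree_diffs L" "y \<in> degree_diffs L"
  shows "x + y \<in> degree_diffs L"
proof -
  obtain w u where 1: "x = int (degree w) - int (degree u)" "w \<in> L - {0}" "u \<in> L - {0}"
    using assms(1) by (auto simp: degree_diffs_def)
  obtain w' u' where 2: "y = int (degree w') - int (degree u')" "w' \<in> L - {0}" "u' \<in> L - {0}"
    using assms(2) by (auto simp: degree_diffs_def)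
  have "Fract w u \<in> ratios L" "Fract w' u' \<in> ratios L"
    using 1 2 by (auto simp: ratios_def)
  then have "Fract (w * w') (u * u') \<in> ratios L"
    using ratios_mult by fastforce
  then have "int (degree (w * w')) - int (degree (u * u')) \<in> degree_diffs L"
    by (rule degree_Fract_in_ratios) (use 1 2 in auto)
  moreover have "int (degree (w * w')) - int (degree (u * u')) = x + y"
    using 1 2 by (simp add: degree_mult_eq)
  ultimately show ?thesis by simp
qed

lemma degree_diffs_uminus: "x \<in> degree_diffs L \<Longrightarrow> - x \<in> degree_diffs L"
  unfolding degree_diffs_def by force

lemma unbounded_degrees: "\<exists>f\<in>L - {0}. degree f > n"
  using infinite_degrees[OF subspace infdim] unfolding infinite_nat_iff_unbounded by blast

text \<open>A bracket with \<open>g\<close> has degree \<open>degree f + degree g - 1\<close>, and subtracting the degree of \<open>g\<close>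
  leaves \<open>degree f - 1\<close>.\<close>

lemma degree_pred_in_diffs:
  assumes "f \<in> L - {0}"
  shows "int (degree f) - 1 \<in> degree_diffs L"
proof -
  obtain g where g: "g \<in> L - {0}" "degree g > degree f" using unbounded_degrees by blast
  have "W_bracket f g \<in> L - {0}" "degree (W_bracket f g) = degree f + degree g - 1"
    using degree_W_bracket[of f g] assms g L by (auto simp: lie_subalgebra_def)
  then have "int (degree (W_bracket f g)) - int (degree g) \<in> degree_diffs L"
      "int (degree (W_bracket f g)) - int (degree g) = int (degree f) - 1"
    using g unfolding degree_diffs_def by (blast, simp add: of_nat_diff)
  then show ?thesis by simp
qed

text \<open>This is where closure of the ratios under sums enters. A sum \<open>\<Sum>f\<^sub>ig\<^sub>i\<close> may lose arbitrarily many
  leading terms, but after division by \<open>u\<^sup>2\<close> it is still an element of the field of ratios, so its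
  degree stays in a fixed residue class.\<close>

lemma degree_quadratic_pair:
  assumes "(a, b) \<in> quadratic_pairs L" "a \<noteq> 0"
  shows "int (degree a) - 2 \<in> degree_diffs L"
proof -
  obtain u where u: "u \<in> L - {0}" using unbounded_degrees by blast
  have ratio: "Fract f u \<in> ratios L" if "f \<in> L" for f
    using that u by (auto simp: ratios_def)
  have "Fract a (u * u) \<in> ratios L"
    using assms(1)
  proof induction
    case zero
    have "Fract 0 (u * u) = 0" using u by (simp add: Zero_fract_def eq_fract)
    then show ?case using ratios_0 by simp
  next
    case (add f g a b)
    have "Fract (a + f * g) (u * u) = Fract a (u * u) + Fract f u * Fract g u"
      using u by (simp add: eq_fract algebra_simps)
    then show ?case using ratios_add[OF add.IH ratios_mult[OF ratio ratio]] add by simp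
  qed
  then have "int (degree a) - int (degree (u * u)) \<in> degree_diffs L"
    by (rule degree_Fract_in_ratios) (use u assms in auto)
  then have *: "int (degree a) - 2 * int (degree u) \<in> degree_diffs L"
    using u by (simp add: degree_mult_eq)
  show ?thesis
    using degree_diffs_add[OF degree_diffs_add[OF * degree_pred_in_diffs[OF u]] degree_pred_in_diffs[OF u]]
    by (simp add: algebra_simps)
qed

text \<open>The degrees of ratios form a group \<open>d\<int>\<close>, and by the bracket the numbers \<open>degree f - 1\<close> lie in it
  and are closed under sums of distinct elements. As \<open>d\<close> itself is the degree of a ratio, two of
  these numbers differ by exactly \<open>d\<close>, so after division by \<open>d\<close> two of them are consecutive.\<close>

lemma degrees_eventually_progression:
  obtains d n\<^sub>0 where "d > 0" "degree_diffs L = range ((*) d)"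
    "\<And>n. n \<ge> n\<^sub>0 \<Longrightarrow> d dvd int n - 1 \<Longrightarrow> \<exists>f\<in>L - {0}. degree f = n"
proof -
  obtain f where f: "f \<in> L - {0}" using unbounded_degrees by blast
  obtain g where g: "g \<in> L - {0}" "degree g > degree f" using unbounded_degrees by blast
  have "int (degree g) - int (degree f) \<in> degree_diffs L"
    using f g by (auto simp: degree_diffs_def)
  moreover have "x - y \<in> degree_diffs L" if "x \<in> degree_diffs L" "y \<in> degree_diffs L" for x y
    using degree_diffs_add[OF that(1) degree_diffs_uminus[OF that(2)]] by simp
  ultimately obtain d where d: "d > 0" "degree_diffs L = range ((*) d)"
    using int_subgroup_eq_multiples[of "degree_diffs L"] g(2) by (metis eq_iff_diff_eq_0 of_nat_eq_iff less_irrefl)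
  define A where "A = {q. \<exists>f\<in>L - {0}. int (degree f) - 1 = d * q}"
  have A: "\<exists>q\<in>A. int (degree f) - 1 = d * q" if "f \<in> L - {0}" for f
    using degree_pred_in_diffs[OF that] that unfolding d(2) A_def by blast
  have "d \<in> degree_diffs L" unfolding d(2) by (rule image_eqI[of _ _ 1]) auto
  then obtain w u where wu: "d = int (degree w) - int (degree u)" "w \<in> L - {0}" "u \<in> L - {0}"
    by (auto simp: degree_diffs_def)
  obtain \<alpha> where \<alpha>: "\<alpha> \<in> A" "int (degree u) - 1 = d * \<alpha>" using A[OF wu(3)] by blast
  have "\<alpha> + 1 \<in> A"
    unfolding A_def using wu \<alpha>(2) by (auto simp: algebra_simps intro!: bexI[of _ w])
  have "\<exists>n. \<forall>q\<ge>n. q \<in> A"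
  proof (rule distinct_sum_closed_eventually_all[OF _ \<alpha>(1) \<open>\<alpha> + 1 \<in> A\<close>])
    fix x y assume "x \<in> A" "y \<in> A" "x \<noteq> y"
    then obtain f g where fg: "f \<in> L - {0}" "int (degree f) - 1 = d * x"
      "g \<in> L - {0}" "int (degree g) - 1 = d * y" by (auto simp: A_def)
    have "d * x \<noteq> d * y" using \<open>x \<noteq> y\<close> d(1) by simp
    then have "degree f \<noteq> degree g" using fg by auto
    then have "W_bracket f g \<in> L - {0}" "degree (W_bracket f g) = degree f + degree g - 1"
      using degree_W_bracket[of f g] fg L by (auto simp: lie_subalgebra_def)
    moreover have "int (degree f + degree g - 1) - 1 = d * (x + y)"
      using fg \<open>degree f \<noteq> degree g\<close> by (simp add: algebra_simps of_nat_diff)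
    ultimately show "x + y \<in> A" unfolding A_def by (metis (mono_tags) mem_Collect_eq)
  next
    fix n
    obtain f where f: "f \<in> L - {0}" "degree f > nat (d * \<bar>n\<bar> + 1)" using unbounded_degrees by blast
    obtain q where q: "q \<in> A" "int (degree f) - 1 = d * q" using A[OF f(1)] by blast
    have "d * \<bar>n\<bar> < d * q" using f(2) q(2) by linarith
    then have "n < q" using d(1) by simp
    with q(1) show "\<exists>q\<in>A. n < q" by blast
  qed
  then obtain q\<^sub>0 where q\<^sub>0: "\<And>q. q \<ge> q\<^sub>0 \<Longrightarrow> q \<in> A" by blast
  show thesis
  proof (rule that[OF d, of "nat (d * \<bar>q\<^sub>0\<bar> + 1)"])
    fix n assume n: "n \<ge> nat (d * \<bar>q\<^sub>0\<bar> + 1)" "d dvd int n - 1"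
    then obtain q where q: "int n - 1 = d * q" by blast
    have "d * \<bar>q\<^sub>0\<bar> \<le> d * q" using n(1) q by linarith
    then have "q \<in> A" using d(1) by (intro q\<^sub>0) simp
    then obtain f where "f \<in> L - {0}" "int (degree f) - 1 = d * q" by (auto simp: A_def)
    with q show "\<exists>f\<in>L - {0}. degree f = n" by (intro bexI[of _ f]) auto
  qed
qed

text \<open>On leading terms of degrees \<open>i\<close> and \<open>j\<close> the pair \<open>(uv, u'v')\<close> is \<open>(t\<^sup>N, ij t\<^sup>N\<^sup>-\<^sup>2)\<close> with
  \<open>N = i + j\<close>. Two splittings of \<open>N\<close> with different products \<open>ij\<close> allow the first leading term to be
  cancelled without cancelling the second.\<close>

lemma quadratic_pair_cancel_top:
  assumes f: "f \<in> L" "g \<in> L" "degree f > 0" "degree g > 0"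
    and h: "h \<in> L" "k \<in> L" "degree h > 0" "degree k > 0"
    and N: "degree f + degree g = N" "degree h + degree k = N"
    and ne: "degree f * degree g \<noteq> degree h * degree k"
  shows "\<exists>(a, b)\<in>quadratic_pairs L. (\<forall>i\<ge>N. coeff a i = 0) \<and> degree b = N - 2"
proof -
  define c where "c = (lead_coeff f * lead_coeff g) / (lead_coeff h * lead_coeff k)"
  let ?a = "f * g - Polynomial.smult c (h * k)"
  let ?b = "pderiv f * pderiv g - Polynomial.smult c (pderiv h * pderiv k)"
  have hk: "lead_coeff h * lead_coeff k \<noteq> 0" and fg: "lead_coeff f * lead_coeff g \<noteq> 0" using f h by auto
  have mem: "(?a, ?b) \<in> quadratic_pairs L"
    by (rule quadratic_pairs_diff[OF subspace quadratic_pairs_mult[OF f(1,2)] quadratic_pairs_mult[OF h(1,2)]])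
  have a: "coeff ?a i = 0" if "i \<ge> N" for i
  proof (cases "i = N")
    case True
    then show ?thesis
      using coeff_mult_degree_sum[of f g] coeff_mult_degree_sum[of h k] N hk by (simp add: c_def)
  next
    case False
    then have "coeff (f * g) i = 0" "coeff (h * k) i = 0"
      using that N degree_mult_le[of f g] degree_mult_le[of h k] by (auto intro!: coeff_eq_0)
    then show ?thesis by simp
  qed
  have pd: "degree (pderiv p * pderiv q) \<le> N - 2"
      "coeff (pderiv p * pderiv q) (N - 2) = of_nat (degree p * degree q) * (lead_coeff p * lead_coeff q)"
    if "degree p > 0" "degree q > 0" "degree p + degree q = N" for p q :: "'k poly"
  proof -
    have N2: "N - 2 = degree (pderiv p) + degree (pderiv q)" using that by (simp add: degree_pderiv)
    show "degree (pderiv p * pderiv q) \<le> N - 2" unfolding N2 by (rule degree_mult_le)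
    show "coeff (pderiv p * pderiv q) (N - 2) = of_nat (degree p * degree q) * (lead_coeff p * lead_coeff q)"
      unfolding N2 coeff_mult_degree_sum using that by (simp add: degree_pderiv coeff_pderiv)
  qed
  have "degree ?b \<le> N - 2"
    using pd(1)[OF f(3,4) N(1)] order.trans[OF degree_smult_le pd(1)[OF h(3,4) N(2)]]
    by (rule degree_diff_le)
  moreover have "coeff ?b (N - 2) =
      (of_nat (degree f * degree g) - of_nat (degree h * degree k)) * (lead_coeff f * lead_coeff g)"
    using pd(2)[OF f(3,4) N(1)] pd(2)[OF h(3,4) N(2)] hk
    by (simp add: c_def left_diff_distrib del: of_nat_mult)
  then have "coeff ?b (N - 2) \<noteq> 0" using fg ne by (simp del: of_nat_mult)
  then have "degree ?b \<ge> N - 2" by (rule le_degree)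
  ultimately show ?thesis using mem a by (intro bexI[OF _ mem]) auto
qed

text \<open>For each large \<open>N\<close> with \<open>N - 2 \<in> d\<int>\<close> there is a pair whose first component has degree below \<open>N\<close>
  while the second has degree \<open>N - 2\<close>. The first component has its degree \<open>n\<close> again in the class of
  \<open>2\<close> modulo \<open>d\<close>, so for large \<open>n\<close> its leading term is that of a product \<open>f g\<close> of two elements of \<open>L\<close>.
  Subtracting this product changes the second component only in degree \<open>n - 2 < N - 2\<close>. Repeating
  the step bounds the first component independently of \<open>N\<close>, and elimination removes it.\<close>

lemma infinite_degrees_quadratic_kernel:
  "infinite {degree b | b. (0, b) \<in> quadratic_pairs L}"
proof -
  obtain d n\<^sub>0 where d: "d > 0" "degree_diffs L = range ((*) d)"
    and n\<^sub>0: "\<And>n. n \<ge> n\<^sub>0 \<Longrightarrow> d dvd int n - 1 \<Longrightarrow> \<exists>f\<in>L - {0}. degree f = n"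
    by (rule degrees_eventually_progression) blast
  define m where "m = 1 + n\<^sub>0 * nat d + nat d"
  \<comment> \<open>Above \<open>M\<close>, the splittings \<open>m + (N - m)\<close> and \<open>(m + d) + (N - m - d)\<close> of \<open>N\<close> have their parts
    in increasing order \<open>m < m + d < N - m - d < N - m\<close>, so that their products differ.\<close>
  define M where "M = 2 * m + 2 * nat d + 1"
  have "n\<^sub>0 * 1 \<le> n\<^sub>0 * nat d" by (rule mult_le_mono2) (use d(1) in simp)
  then have "m \<ge> n\<^sub>0" unfolding m_def by linarith
  moreover have "m > 0" "d dvd int m - 1"
    using d(1) by (auto simp: m_def)
  ultimately have m: "m \<ge> n\<^sub>0" "m > 0" "d dvd int m - 1" by blast+
  have element: "\<exists>f\<in>L. degree f = n" if "n \<ge> m" "d dvd int n - 1" for n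
    using n\<^sub>0[of n] m(1) that by auto
  have product: "\<exists>f\<in>L. \<exists>g\<in>L. degree f > 0 \<and> degree g > 0 \<and> degree f + degree g = N"
    and top: "\<exists>(a, b)\<in>quadratic_pairs L. (\<forall>i\<ge>N. coeff a i = 0) \<and> degree b = N - 2"
    if N: "N \<ge> M" "d dvd int N - 2" for N
  proof -
    have "d dvd (int N - 2) - (int m - 1)" using N(2) m(3) by (rule dvd_diff)
    then have dvd: "d dvd int (N - m) - 1" using N(1) by (simp add: M_def of_nat_diff algebra_simps)
    then have dvd': "d dvd int (N - m - nat d) - 1"
      using dvd_diff[OF dvd dvd_refl] N(1) d(1) by (simp add: M_def of_nat_diff algebra_simps)
    have dvd'': "d dvd int (m + nat d) - 1"
      using dvd_add[OF m(3) dvd_refl] d(1) by (simp add: algebra_simps)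
    have le: "N - m \<ge> m" "N - m - nat d \<ge> m" using N(1) unfolding M_def by arith+
    obtain f where f: "f \<in> L" "degree f = m" using element[of m] m(3) by auto
    obtain g where g: "g \<in> L" "degree g = N - m" using element[OF le(1) dvd] by blast
    obtain h where h: "h \<in> L" "degree h = m + nat d" using element[OF _ dvd''] by auto
    obtain k where k: "k \<in> L" "degree k = N - m - nat d"
      using element[OF le(2) dvd'] by blast
    show "\<exists>f\<in>L. \<exists>g\<in>L. degree f > 0 \<and> degree g > 0 \<and> degree f + degree g = N"
      using f g m(2) N(1) by (intro bexI[of _ f] bexI[of _ g]) (auto simp: M_def)
    obtain r where r: "N = 2 * m + 2 * nat d + 1 + r" using N(1) by (auto simp: M_def le_iff_add)
    have "m * (N - m) \<noteq> (m + nat d) * (N - m - nat d)"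
      using d(1) by (simp add: r algebra_simps)
    then show "\<exists>(a, b)\<in>quadratic_pairs L. (\<forall>i\<ge>N. coeff a i = 0) \<and> degree b = N - 2"
      using f g h k m(2) N(1) by (intro quadratic_pair_cancel_top[of f g h k]) (auto simp: M_def)
  qed
  have reduced: "\<exists>(a, b)\<in>quadratic_pairs L. (\<forall>i\<ge>n. coeff a i = 0) \<and> degree b = N - 2"
    if "n \<le> N" "M \<le> n" "d dvd int N - 2" for n N
    using that
  proof (induction n rule: inc_induct)
    case base
    then show ?case using top by simp
  next
    case (step n)
    then obtain a b where ab: "(a, b) \<in> quadratic_pairs L" "\<forall>i\<ge>Suc n. coeff a i = 0" "degree b = N - 2"
      by auto
    show ?case
    proof (cases "coeff a n = 0")
      case True
      then have "\<forall>i\<ge>n. coeff a i = 0" using ab(2) by (metis Suc_leI le_neq_implies_less)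
      with ab show ?thesis by blast
    next
      case False
      then have "a \<noteq> 0" by auto
      have "degree a = n"
        using False ab(2) by (intro antisym le_degree degree_le) auto
      then have "d dvd int n - 2"
        using degree_quadratic_pair[OF ab(1) \<open>a \<noteq> 0\<close>] unfolding d(2) by auto
      then obtain f g where fg: "f \<in> L" "g \<in> L" "degree f > 0" "degree g > 0" "degree f + degree g = n"
        using product step.prems(1) by blast
      define c where "c = coeff a n / (lead_coeff f * lead_coeff g)"
      let ?a = "a - Polynomial.smult c (f * g)"
      let ?b = "b - Polynomial.smult c (pderiv f * pderiv g)"
      have "(?a, ?b) \<in> quadratic_pairs L"
        by (rule quadratic_pairs_diff[OF subspace ab(1) quadratic_pairs_mult[OF fg(1,2)]])
      moreover have "coeff ?a i = 0" if "i \<ge> n" for i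
      proof (cases "i = n")
        case True
        then show ?thesis
          using coeff_mult_degree_sum[of f g] fg by (auto simp: c_def)
      next
        case False
        then have "coeff (f * g) i = 0"
          using that fg degree_mult_le[of f g] by (auto intro!: coeff_eq_0)
        then show ?thesis using False that ab(2) by simp
      qed
      moreover have "degree (Polynomial.smult c (pderiv f * pderiv g)) < degree b"
      proof -
        have "degree (Polynomial.smult c (pderiv f * pderiv g)) \<le> degree (pderiv f) + degree (pderiv g)"
          by (rule order.trans[OF degree_smult_le degree_mult_le])
        also have "\<dots> = n - 2" using fg by (simp add: degree_pderiv)
        also have "\<dots> < N - 2" using step.hyps step.prems fg by auto
        finally show ?thesis using ab(3) by simp
      qed
      then have "degree ?b = N - 2"
        using degree_add_eq_left[of "- Polynomial.smult c (pderiv f * pderiv g)" b] ab(3) by simp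
      ultimately show ?thesis by blast
    qed
  qed
  have "\<exists>n>k. n \<in> {degree b | a b. (a, b) \<in> quadratic_pairs L \<and> (\<forall>i\<ge>M. coeff a i = 0)}" for k
  proof -
    define N where "N = 2 + nat d * (M + k + 1)"
    have "nat d * (M + k + 1) \<ge> 1 * (M + k + 1)" using d(1) by (intro mult_right_mono) auto
    then have N: "M \<le> N" "k < N - 2" by (auto simp: N_def)
    have "d dvd int N - 2" using d(1) by (simp add: N_def)
    from reduced[OF N(1) order.refl this] obtain a b where
      ab: "(a, b) \<in> quadratic_pairs L" "\<forall>i\<ge>M. coeff a i = 0" "degree b = N - 2" by auto
    then have "degree b \<in> {degree b | a b. (a, b) \<in> quadratic_pairs L \<and> (\<forall>i\<ge>M. coeff a i = 0)}"
      by blast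
    moreover have "k < degree b" using N(2) ab(3) by simp
    ultimately show ?thesis by blast
  qed
  then have "infinite {degree b | a b. (a, b) \<in> quadratic_pairs L \<and> (\<forall>i\<ge>M. coeff a i = 0)}"
    unfolding infinite_nat_iff_unbounded by blast
  then show ?thesis
    by (rule infinite_degrees_kernel[rotated]) (rule quadratic_pairs_diff[OF subspace])
qed

end

theorem corollary0p7:
  fixes \<gg> :: "'k::field_char_0 poly set"
  assumes "lie_subalgebra Polynomial.smult W_bracket \<gg>"
    and "infinite_dimensional Polynomial.smult \<gg>"
    and "subfield (ratios \<gg>) (ring_of_type_algebra :: 'k poly fract ring)"
  shows "\<not> noetherian (universal_enveloping_algebra Polynomial.smult W_bracket \<gg>)"
proof -
  interpret lie_subalgebra_ratio_field \<gg> by (rule lie_subalgebra_ratio_field.intro) (fact assms)+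
  show ?thesis
    unfolding noetherian_def
    using not_right_noetherian_if_quadratic_pairs[OF L infinite_degrees_quadratic_kernel] by blast
qed

end
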